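(* Let $m\ge 1$. For a given $\eta\in(1,\infty]$, the set $\mathcal{HP}_\eta$ of $m\times m$-valued rational functions is matrix-convex. It is also closed under inversion, i.e. whenever a rational function $F(s)$ is in $\mathcal{HP}_\eta$, then $\left(F(s)\right)^{-1}$ is well defined and belongs to $\mathcal{HP}_\eta$, with the same $\eta$.
   Context: $\mathbb{C}_R$ denotes the open right half of the complex plane, and for $\eta=\infty$ one sets $\frac1\eta=0$ and $\frac{\eta+1}{\eta-1}=1$. For $\eta\in(1,\infty]$, $\mathcal{HB}_\eta$ ($\eta$-Hyper-Bounded Real functions) is the set of $m\times m$-valued rational functions $G(s)$, analytic in $\mathbb{C}_R$, such that $I_m-\frac{\eta+1}{\eta-1}\,G(s)^*G(s)$ is positive semi-definite for all $s\in\mathbb{C}_R$. The Cayley transform of a square matrix $M$ with $-1\notin\mathrm{spect}(M)$ is $\mathcal{C}(M)=(I-M)(I+M)^{-1}$. The set $\mathcal{HP}_\eta$ (Quantitatively Hyper-Positive Real functions) is the image $\mathcal{HP}_\eta=\mathcal{C}(\mathcal{HB}_\eta)$ under the Cayley transform (wherever it is well defined). Equivalently, $\mathcal{HP}_\eta$ is the set of $m\times m$-valued rational functions $F(s)$, analytic in $\mathbb{C}_R$, such that $$F(s)+F(s)^*-\tfrac1\eta\left(F(s)^*F(s)+I_m\right)$$ is (Hermitian) positive semi-definite for all $s\in\mathbb{C}_R$. For $\eta=\infty$ this is the set of positive real functions. Matrix-convexity: a set $\mathcal{F}$ of $m\times m$-valued rational functions is called matrix-convex if for every natural number $k$, all constant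 $m\times m$ matrices $\upsilon_1,\ldots,\upsilon_k$ with $\sum_{j=1}^k\upsilon_j^*\upsilon_j=I_m$ (i.e. the $mk\times m$ block column with blocks $\upsilon_1,\ldots,\upsilon_k$ is an isometry), and all $F_1,\ldots,F_k\in\mathcal{F}$, the function $\sum_{j=1}^k\upsilon_j^*F_j(s)\upsilon_j$ belongs to $\mathcal{F}$.
   Formalization: For η=∞ the inversion claim is stated only for F whose determinant is not identically zero, since F=0 is positive real and has no inverse; for finite η invertibility is part of the conclusion. *)

theory Defs
  imports
    "HOL-Analysis.Analysis"
    "HOL-Computational_Algebra.Polynomial_Factorial"
begin

section \<open>Rational functions\<close>

text \<open>
  A scalar rational function is an element of the field of fractions of the polynomial ring over
  the complex numbers, and a matrix-valued one is a matrix over that field.  Products, inverses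
  and determinants of matrix-valued rational functions are those of matrices over a field.
\<close>

type_synonym ratfun = "complex poly fract"

type_synonym 'm ratmat = "ratfun ^ 'm ^ 'm"

text \<open>
  The value at \<open>s\<close> uses any representation whose denominator does not vanish at \<open>s\<close>, so removable
  singularities are removed.  At a pole no such representation exists and the value is unspecified;
  \<open>rat_eval_analytic_on_iff\<close> below shows that analyticity is not affected by that.
\<close>

definition rat_eval :: "ratfun \<Rightarrow> complex \<Rightarrow> complex" where
  "rat_eval f s =
     (THE v. \<exists>p q. f = Fraction_Field.Fract p q \<and> poly q s \<noteq> 0 \<and> v = poly p s / poly q s)"

definition ratmat_eval :: "'m::finite ratmat \<Rightarrow> complex \<Rightarrow> complex^'m^'m" where
  "ratmat_eval F s = map_matrix (\<lambda>f. rat_eval f s) F"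

definition const_ratmat :: "complex^'m^'m \<Rightarrow> 'm::finite ratmat" where
  "const_ratmat A = map_matrix (\<lambda>c. to_fract [:c:]) A"

definition right_half_plane :: "complex set" where
  "right_half_plane = {s. 0 < Re s}"

definition ratmat_analytic_on :: "'m::finite ratmat \<Rightarrow> complex set \<Rightarrow> bool" where
  "ratmat_analytic_on F S \<longleftrightarrow> (\<forall>i j. rat_eval (F $ i $ j) analytic_on S)"

lemma rat_eval_Fract:
  assumes "poly q s \<noteq> 0"
  shows "rat_eval (Fraction_Field.Fract p q) s = poly p s / poly q s"
  unfolding rat_eval_def
proof (rule the_equality)
  show "\<exists>p' q'. Fraction_Field.Fract p q = Fraction_Field.Fract p' q' \<and> poly q' s \<noteq> 0
      \<and> poly p s / poly q s = poly p' s / poly q' s"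
    using assms by blast
next
  fix v
  assume "\<exists>p' q'. Fraction_Field.Fract p q = Fraction_Field.Fract p' q' \<and> poly q' s \<noteq> 0
      \<and> v = poly p' s / poly q' s"
  then obtain p' q' where e: "Fraction_Field.Fract p q = Fraction_Field.Fract p' q'"
    and n: "poly q' s \<noteq> 0" and v: "v = poly p' s / poly q' s" by blast
  have "q \<noteq> 0" "q' \<noteq> 0" using assms n by auto
  then have "p * q' = p' * q" using e by (simp add: eq_fract)
  then have "poly p s * poly q' s = poly p' s * poly q s" by (metis poly_mult)
  then show "v = poly p s / poly q s" using assms n v by (simp add: frac_eq_eq)
qed

lemma rat_eval_analytic_on_iff:
  "rat_eval f analytic_on S \<longleftrightarrow>
     (\<forall>s\<in>S. \<exists>p q. f = Fraction_Field.Fract p q \<and> poly q s \<noteq> 0)"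
proof
  assume an: "rat_eval f analytic_on S"
  show "\<forall>s\<in>S. \<exists>p q. f = Fraction_Field.Fract p q \<and> poly q s \<noteq> 0"
  proof
    fix s assume "s \<in> S"
    then have cont: "isCont (rat_eval f) s"
      using an analytic_at_imp_isCont analytic_on_analytic_at by blast
    define P where
      "P n \<longleftrightarrow> (\<exists>p q. f = Fraction_Field.Fract p q \<and> q \<noteq> 0 \<and> degree q = n)" for n
    obtain p0 q0 where "f = Fraction_Field.Fract p0 q0" "q0 \<noteq> 0"
      by (cases f) auto
    then have "P (degree q0)" unfolding P_def by blast
    then have "P (LEAST n. P n)" by (rule LeastI)
    then obtain p q where f: "f = Fraction_Field.Fract p q" and q: "q \<noteq> 0"
      and dq: "degree q = (LEAST n. P n)" unfolding P_def by blast
    have "poly q s \<noteq> 0"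
    proof
      assume q0: "poly q s = 0"
      have "eventually (\<lambda>z. poly q z \<noteq> 0) (at s)"
        using islimpt_finite[OF poly_roots_finite[OF q]] by (simp add: islimpt_iff_eventually)
      then have "eventually (\<lambda>z. rat_eval f z * poly q z = poly p z) (at s)"
        by eventually_elim (simp add: f rat_eval_Fract)
      moreover have "((\<lambda>z. rat_eval f z * poly q z) \<longlongrightarrow> rat_eval f s * poly q s) (at s)"
        using cont by (intro tendsto_mult) (auto simp: isCont_def intro: tendsto_poly tendsto_ident_at)
      ultimately have "((\<lambda>z. poly p z) \<longlongrightarrow> rat_eval f s * poly q s) (at s)"
        by (rule Lim_transform_eventually[rotated])
      moreover have "((\<lambda>z. poly p z) \<longlongrightarrow> poly p s) (at s)"
        by (intro tendsto_poly tendsto_ident_at)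
      ultimately have "poly p s = 0"
        using q0 tendsto_unique[OF trivial_limit_at] by fastforce
      then obtain p' where p': "p = [:-s, 1:] * p'" by (auto simp: poly_eq_0_iff_dvd)
      obtain q' where q': "q = [:-s, 1:] * q'" using q0 by (auto simp: poly_eq_0_iff_dvd)
      have q'0: "q' \<noteq> 0" using q q' by auto
      have "f = Fraction_Field.Fract p' q'"
        unfolding f p' q' by (rule mult_fract_cancel) simp
      then have "P (degree q')" using q'0 unfolding P_def by blast
      then have "(LEAST n. P n) \<le> degree q'" by (rule Least_le)
      moreover have "degree q = Suc (degree q')"
        using q'0 unfolding q' by (subst degree_mult_eq) auto
      ultimately show False using dq by simp
    qed
    then show "\<exists>p q. f = Fraction_Field.Fract p q \<and> poly q s \<noteq> 0" using f by blast
  qed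
next
  assume r: "\<forall>s\<in>S. \<exists>p q. f = Fraction_Field.Fract p q \<and> poly q s \<noteq> 0"
  have "rat_eval f analytic_on {s}" if s: "s \<in> S" for s
  proof -
    obtain p q where f: "f = Fraction_Field.Fract p q" and q: "poly q s \<noteq> 0"
      using r s by blast
    let ?U = "{z. poly q z \<noteq> 0}"
    have "open ?U"
      by (rule open_Collect_neq) (intro continuous_on_poly continuous_on_id continuous_on_const)+
    moreover have "rat_eval f holomorphic_on ?U"
    proof (rule holomorphic_transform)
      show "(\<lambda>z. poly p z / poly q z) holomorphic_on ?U"
        by (intro holomorphic_intros) auto
    qed (simp add: f rat_eval_Fract)
    ultimately show ?thesis
      using q unfolding analytic_at by (intro exI[of _ ?U] conjI) simp_all
  qed
  then show "rat_eval f analytic_on S" by (subst analytic_on_analytic_at) (rule ballI)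
qed

section \<open>Complex matrices\<close>

definition conj_transpose :: "complex^'m^'n \<Rightarrow> complex^'n^'m" where
  "conj_transpose A = (\<chi> i j. cnj (A $ j $ i))"

definition pos_semidef :: "complex^'m^'m::finite \<Rightarrow> bool" where
  "pos_semidef A \<longleftrightarrow> conj_transpose A = A \<and>
     (\<forall>v::complex^'m. 0 \<le> Re (\<Sum>i\<in>UNIV. cnj (v $ i) * (A *v v) $ i))"

definition spect :: "'a::field^'m^'m::finite \<Rightarrow> 'a set" where
  "spect A = {c. \<exists>v. v \<noteq> 0 \<and> A *v v = c *s v}"

definition cayley :: "'a::field^'m^'m::finite \<Rightarrow> 'a^'m^'m" where
  "cayley M = (mat 1 - M) ** matrix_inv (mat 1 + M)"

section \<open>Hyper-bounded and hyper-positive rational functions\<close>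

text \<open>The constant \<open>(\<eta> + 1) / (\<eta> - 1)\<close>, which is \<open>1\<close> by convention for \<open>\<eta> = \<infinity>\<close>.\<close>

definition hb_const :: "ereal \<Rightarrow> real" where
  "hb_const \<eta> =
     (if \<eta> = \<infinity> then 1 else (real_of_ereal \<eta> + 1) / (real_of_ereal \<eta> - 1))"

definition HB :: "ereal \<Rightarrow> 'm::finite ratmat set" where
  "HB \<eta> = {G. ratmat_analytic_on G right_half_plane \<and>
     (\<forall>s\<in>right_half_plane.
        pos_semidef (mat 1 - hb_const \<eta> *\<^sub>R (conj_transpose (ratmat_eval G s) ** ratmat_eval G s)))}"

text \<open>
  The Cayley transform is taken of \<open>G\<close> as a matrix over the field of rational functions; it is well
  defined when \<open>-1\<close> is not an eigenvalue there, i.e. when \<open>det (I + G(s))\<close> is not identically zero.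
\<close>

definition HP :: "ereal \<Rightarrow> 'm::finite ratmat set" where
  "HP \<eta> = cayley ` {G \<in> HB \<eta>. -1 \<notin> spect G}"

definition matrix_convex :: "'m::finite ratmat set \<Rightarrow> bool" where
  "matrix_convex \<F> \<longleftrightarrow>
     (\<forall>(k::nat) (\<upsilon> :: nat \<Rightarrow> complex^'m^'m) (F :: nat \<Rightarrow> 'm ratmat).
        (\<Sum>j<k. conj_transpose (\<upsilon> j) ** \<upsilon> j) = mat 1 \<longrightarrow> (\<forall>j<k. F j \<in> \<F>) \<longrightarrow>
        (\<Sum>j<k. const_ratmat (conj_transpose (\<upsilon> j)) ** F j ** const_ratmat (\<upsilon> j)) \<in> \<F>)"

text \<open>
  The zero function is positive real: it is the Cayley transform of the constant \<open>I\<close>.  Hence for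
  \<open>\<eta> = \<infinity>\<close> membership alone does not make a function invertible.
\<close>

lemma zero_in_HP_infinity: "(0 :: 'm::finite ratmat) \<in> HP \<infinity>"
proof -
  have one: "rat_eval 1 s = 1" "rat_eval 0 s = 0" for s
    using rat_eval_Fract[of 1 s 1] rat_eval_Fract[of 1 s 0]
    by (simp_all add: One_fract_def Zero_fract_def)
  have ev: "ratmat_eval (mat 1 :: 'm ratmat) s = mat 1" for s
    by (simp add: ratmat_eval_def map_matrix_def mat_def one vec_eq_iff)
  have "\<exists>p q. (mat 1 :: 'm ratmat) $ i $ j = Fraction_Field.Fract p q \<and> poly q s \<noteq> 0" for i j s
    by (rule exI[of _ "if i = j then 1 else 0"], rule exI[of _ 1])
      (simp add: mat_def One_fract_def Zero_fract_def)
  then have an: "ratmat_analytic_on (mat 1 :: 'm ratmat) right_half_plane"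
    unfolding ratmat_analytic_on_def rat_eval_analytic_on_iff by blast
  have ct: "conj_transpose (mat 1 :: complex^'m^'m) = mat 1"
    by (simp add: conj_transpose_def mat_def vec_eq_iff)
  have "pos_semidef (0 :: complex^'m^'m)"
    by (simp add: pos_semidef_def conj_transpose_def vec_eq_iff)
  then have HB: "(mat 1 :: 'm ratmat) \<in> HB \<infinity>"
    by (simp add: HB_def an ev ct hb_const_def)
  have "(of_nat 2 :: ratfun) \<noteq> 0"
    by (simp add: of_nat_fract Zero_fract_def eq_fract del: of_nat_numeral)
  then have two: "(2 :: ratfun) \<noteq> 0" by simp
  have "-1 \<notin> spect (mat 1 :: 'm ratmat)"
  proof
    assume "-1 \<in> spect (mat 1 :: 'm ratmat)"
    then obtain v :: "ratfun^'m" where v: "v \<noteq> 0" "v = (-1) *s v"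
      by (auto simp: spect_def)
    then obtain i where i: "v $ i \<noteq> 0" by (auto simp: vec_eq_iff)
    have "v $ i = - (v $ i)" using v(2) by (metis vector_smult_component mult_minus1)
    then have "2 * v $ i = 0" by (simp add: eq_neg_iff_add_eq_0)
    then show False using two i by simp
  qed
  moreover have "cayley (mat 1 :: 'm ratmat) = 0"
    by (simp add: cayley_def matrix_matrix_mult_def vec_eq_iff)
  ultimately show ?thesis
    unfolding HP_def using HB by (force intro: rev_image_eqI)
qed

end

theory Submission
  imports Defs "HOL-Complex_Analysis.Conformal_Mappings"
begin

text \<open>
  Write \<open>c\<close> for the constant \<open>(\<eta> + 1) / (\<eta> - 1) \<ge> 1\<close>.  With the real inner product
  \<open>x \<bullet> y = Re (x\<^sup>* y)\<close> on complex vectors, hyper-boundedness of \<open>G\<close> says that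
  \<open>c \<parallel>G(s) w\<parallel>\<^sup>2 \<le> \<parallel>w\<parallel>\<^sup>2\<close> for all \<open>w\<close>.  Substituting \<open>v = (I + G(s)) w\<close>, so that the Cayley
  transform \<open>F\<close> of \<open>G\<close> has \<open>F(s) v = (I - G(s)) w\<close>, and using the parallelogram law turns this into
  \<open>(c - 1) (\<parallel>v\<parallel>\<^sup>2 + \<parallel>F(s) v\<parallel>\<^sup>2) \<le> 2 (c + 1) (v \<bullet> F(s) v)\<close>, which is the inequality that describes
  \<open>HP \<eta>\<close>, because \<open>(c - 1) / (c + 1) = 1 / \<eta>\<close>; the form with \<open>c\<close> covers \<open>\<eta> = \<infinity>\<close>, \<open>c = 1\<close> without
  a case distinction.

  The pointwise description \<open>HP_iff\<close> needs \<open>F\<close> to have no pole in the right half plane.  A pole can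
  only come from a point where \<open>-1\<close> is an eigenvalue of \<open>G(s)\<close>.  If \<open>c > 1\<close> there is no such point; if
  \<open>c = 1\<close> the maximum principle shows that one such point forces \<open>det (I + G)\<close> to vanish
  identically (\<open>one_plus_contractive_nonsingular\<close>).

  Matrix convexity then follows because the inequality is convex in the pair \<open>(v, F v)\<close>: an
  isometric block column \<open>(\<upsilon>\<^sub>j)\<close> splits \<open>v\<close> into pieces \<open>\<upsilon>\<^sub>j v\<close> of the same total norm, preserves
  the inner product with the image, and its adjoint, a contraction, does not increase the norm of
  the image (\<open>hyper_positive_matrix_convex\<close>).

  Closure under inversion comes from the other side of the Cayley transform: \<open>HB \<eta>\<close> is closed
  under \<open>G \<mapsto> - G\<close>, and replacing \<open>G\<close> by \<open>- G\<close> inverts \<open>(I - G) (I + G)\<^sup>-\<^sup>1\<close>.  For finite \<open>\<eta>\<close> the term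
  \<open>(c - 1) \<parallel>v\<parallel>\<^sup>2\<close> makes \<open>F(s)\<close> injective, so that the inverse exists.
\<close>

section \<open>Evaluation of rational functions\<close>

definition rat_regular_at :: "ratfun \<Rightarrow> complex \<Rightarrow> bool" where
  "rat_regular_at f s \<longleftrightarrow> (\<exists>p q. f = Fraction_Field.Fract p q \<and> poly q s \<noteq> 0)"

lemma rat_regular_atE:
  assumes "rat_regular_at f s"
  obtains p q where "f = Fraction_Field.Fract p q" "poly q s \<noteq> 0" "q \<noteq> 0"
    "rat_eval f s = poly p s / poly q s"
  using assms rat_eval_Fract unfolding rat_regular_at_def by fastforce

lemma rat_eval_add:
  assumes "rat_regular_at f s" "rat_regular_at g s"
  shows "rat_regular_at (f + g) s" "rat_eval (f + g) s = rat_eval f s + rat_eval g s"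
proof -
  obtain p q where f: "f = Fraction_Field.Fract p q" "poly q s \<noteq> 0" "q \<noteq> 0"
    "rat_eval f s = poly p s / poly q s" using assms(1) by (rule rat_regular_atE)
  obtain p' q' where g: "g = Fraction_Field.Fract p' q'" "poly q' s \<noteq> 0" "q' \<noteq> 0"
    "rat_eval g s = poly p' s / poly q' s" using assms(2) by (rule rat_regular_atE)
  have *: "f + g = Fraction_Field.Fract (p * q' + p' * q) (q * q')" "poly (q * q') s \<noteq> 0"
    using f g by simp_all
  then show "rat_regular_at (f + g) s" unfolding rat_regular_at_def by blast
  show "rat_eval (f + g) s = rat_eval f s + rat_eval g s"
    using * f g by (simp add: rat_eval_Fract add_frac_eq)
qed

lemma rat_eval_mult:
  assumes "rat_regular_at f s" "rat_regular_at g s"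
  shows "rat_regular_at (f * g) s" "rat_eval (f * g) s = rat_eval f s * rat_eval g s"
proof -
  obtain p q where f: "f = Fraction_Field.Fract p q" "poly q s \<noteq> 0" "q \<noteq> 0"
    "rat_eval f s = poly p s / poly q s" using assms(1) by (rule rat_regular_atE)
  obtain p' q' where g: "g = Fraction_Field.Fract p' q'" "poly q' s \<noteq> 0" "q' \<noteq> 0"
    "rat_eval g s = poly p' s / poly q' s" using assms(2) by (rule rat_regular_atE)
  have *: "f * g = Fraction_Field.Fract (p * p') (q * q')" "poly (q * q') s \<noteq> 0"
    using f g by simp_all
  then show "rat_regular_at (f * g) s" unfolding rat_regular_at_def by blast
  show "rat_eval (f * g) s = rat_eval f s * rat_eval g s"
    using * f g by (simp add: rat_eval_Fract)
qed

lemma rat_eval_to_fract: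
  "rat_regular_at (to_fract p) s" "rat_eval (to_fract p) s = poly p s"
proof -
  show "rat_regular_at (to_fract p) s"
    unfolding rat_regular_at_def to_fract_def by (rule exI[of _ p], rule exI[of _ 1]) simp
  show "rat_eval (to_fract p) s = poly p s"
    unfolding to_fract_def by (simp add: rat_eval_Fract)
qed

lemma rat_eval_0: "rat_regular_at 0 s" "rat_eval 0 s = 0"
  using rat_eval_to_fract[of 0 s] by simp_all

lemma rat_eval_1: "rat_regular_at 1 s" "rat_eval 1 s = 1"
  using rat_eval_to_fract[of 1 s] by simp_all

lemma rat_eval_uminus:
  assumes "rat_regular_at f s"
  shows "rat_regular_at (- f) s" "rat_eval (- f) s = - rat_eval f s"
proof -
  have m: "- f = to_fract [:-1:] * f"
    by (cases f) (simp add: to_fract_def)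
  show "rat_regular_at (- f) s" "rat_eval (- f) s = - rat_eval f s"
    unfolding m using rat_eval_mult[OF rat_eval_to_fract(1) assms] 
    by (simp_all add: rat_eval_to_fract)
qed

lemma rat_eval_inverse:
  assumes "rat_regular_at f s" "rat_eval f s \<noteq> 0"
  shows "rat_regular_at (inverse f) s"
proof -
  obtain p q where f: "f = Fraction_Field.Fract p q" "poly q s \<noteq> 0"
    "rat_eval f s = poly p s / poly q s" using assms(1) by (rule rat_regular_atE)
  have "inverse f = Fraction_Field.Fract q p" "poly p s \<noteq> 0"
    using f assms(2) by auto
  then show ?thesis unfolding rat_regular_at_def by blast
qed

lemma rat_eval_sum:
  assumes "\<And>i. i \<in> A \<Longrightarrow> rat_regular_at (f i) s"
  shows "rat_regular_at (sum f A) s \<and> rat_eval (sum f A) s = (\<Sum>i\<in>A. rat_eval (f i) s)"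
  using assms
  by (induction A rule: infinite_finite_induct) (simp_all add: rat_eval_0 rat_eval_add)

lemma rat_eval_prod:
  assumes "\<And>i. i \<in> A \<Longrightarrow> rat_regular_at (f i) s"
  shows "rat_regular_at (prod f A) s \<and> rat_eval (prod f A) s = (\<Prod>i\<in>A. rat_eval (f i) s)"
  using assms
  by (induction A rule: infinite_finite_induct) (simp_all add: rat_eval_1 rat_eval_mult)

lemma ratfun_eq_0_if_eval_eq_0:
  assumes "infinite S" "\<And>s. s \<in> S \<Longrightarrow> rat_eval f s = 0"
  shows "f = 0"
proof -
  obtain p q where f: "f = Fraction_Field.Fract p q" "q \<noteq> 0" by (cases f) auto
  have "poly (p * q) s = 0" if "s \<in> S" for s
    \<comment> \<open>\<open>S\<close> may contain roots of the chosen denominator, hence the factor \<open>q\<close>.\<close>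
    using assms(2)[OF that] f by (cases "poly q s = 0") (simp_all add: rat_eval_Fract)
  then have "S \<subseteq> {s. poly (p * q) s = 0}" by auto
  then have "p * q = 0" using assms(1) poly_roots_finite finite_subset by blast
  then show ?thesis using f by (simp add: fract_collapse)
qed

section \<open>Evaluation of matrices of rational functions\<close>

text \<open>
  Evaluation at \<open>s\<close> is a homomorphism only on functions without a pole at \<open>s\<close>, so every identity
  between matrices of rational functions that is to be evaluated comes with a regularity claim.
\<close>

definition ratmat_regular_at :: "'m::finite ratmat \<Rightarrow> complex \<Rightarrow> bool" where
  "ratmat_regular_at F s \<longleftrightarrow> (\<forall>i j. rat_regular_at (F $ i $ j) s)"

lemma ratmat_analytic_on_iff:
  "ratmat_analytic_on F S \<longleftrightarrow> (\<forall>s\<in>S. ratmat_regular_at F s)"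
  unfolding ratmat_analytic_on_def rat_eval_analytic_on_iff ratmat_regular_at_def
    rat_regular_at_def by blast

lemma ratmat_eval_nth: "ratmat_eval F s $ i $ j = rat_eval (F $ i $ j) s"
  by (simp add: ratmat_eval_def)

lemma ratmat_eval_add:
  assumes "ratmat_regular_at F s" "ratmat_regular_at G s"
  shows "ratmat_regular_at (F + G) s" "ratmat_eval (F + G) s = ratmat_eval F s + ratmat_eval G s"
  using assms by (auto simp: ratmat_regular_at_def ratmat_eval_nth rat_eval_add vec_eq_iff)

lemma ratmat_eval_uminus:
  assumes "ratmat_regular_at F s"
  shows "ratmat_regular_at (- F) s" "ratmat_eval (- F) s = - ratmat_eval F s"
  using assms by (auto simp: ratmat_regular_at_def ratmat_eval_nth rat_eval_uminus vec_eq_iff)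

lemma ratmat_eval_diff:
  assumes "ratmat_regular_at F s" "ratmat_regular_at G s"
  shows "ratmat_regular_at (F - G) s" "ratmat_eval (F - G) s = ratmat_eval F s - ratmat_eval G s"
  using ratmat_eval_add[OF assms(1) ratmat_eval_uminus(1)[OF assms(2)]]
  by (simp_all add: ratmat_eval_uminus assms)

lemma ratmat_eval_mult:
  assumes "ratmat_regular_at F s" "ratmat_regular_at G s"
  shows "ratmat_regular_at (F ** G) s" "ratmat_eval (F ** G) s = ratmat_eval F s ** ratmat_eval G s"
proof -
  have "rat_regular_at (F $ i $ k * G $ k $ j) s" for i j k
    using assms by (simp add: ratmat_regular_at_def rat_eval_mult)
  note sums = rat_eval_sum[of UNIV "\<lambda>k. F $ _ $ k * G $ k $ _", OF this]
  show "ratmat_regular_at (F ** G) s"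
    by (simp add: ratmat_regular_at_def matrix_matrix_mult_def sums)
  show "ratmat_eval (F ** G) s = ratmat_eval F s ** ratmat_eval G s"
    using assms
    by (simp add: matrix_matrix_mult_def vec_eq_iff ratmat_eval_nth sums rat_eval_mult
        ratmat_regular_at_def)
qed

lemma ratmat_eval_mat_1:
  "ratmat_regular_at (mat 1) s" "ratmat_eval (mat 1) s = mat 1"
  by (auto simp: ratmat_regular_at_def mat_def vec_eq_iff ratmat_eval_nth rat_eval_0 rat_eval_1)

lemma ratmat_eval_const:
  "ratmat_regular_at (const_ratmat A) s" "ratmat_eval (const_ratmat A) s = A"
  by (auto simp: ratmat_regular_at_def const_ratmat_def vec_eq_iff ratmat_eval_nth
      rat_eval_to_fract)

lemma ratmat_eval_sum:
  assumes "\<And>i. i \<in> A \<Longrightarrow> ratmat_regular_at (F i) s"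
  shows "ratmat_regular_at (sum F A) s \<and> ratmat_eval (sum F A) s = (\<Sum>i\<in>A. ratmat_eval (F i) s)"
proof -
  have "ratmat_regular_at 0 s" "ratmat_eval 0 s = 0"
    by (auto simp: ratmat_regular_at_def vec_eq_iff ratmat_eval_nth rat_eval_0)
  note zero = this
  show ?thesis using assms
    by (induction A rule: infinite_finite_induct) (simp_all add: ratmat_eval_add zero)
qed

lemma ratmat_eval_det:
  fixes F :: "'m::finite ratmat"
  assumes "ratmat_regular_at F s"
  shows "rat_regular_at (det F) s" "rat_eval (det F) s = det (ratmat_eval F s)"
proof -
  let ?t = "\<lambda>p. of_int (sign p) * (\<Prod>i\<in>UNIV. F $ i $ p i)"
  have sgn: "rat_regular_at (of_int (sign p)) s \<and> rat_eval (of_int (sign p)) s = of_int (sign p)"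
    for p :: "'m \<Rightarrow> 'm"
    by (rule sign_cases[of p]) (simp_all add: rat_eval_1 rat_eval_uminus)
  have pr: "rat_regular_at (\<Prod>i\<in>UNIV. F $ i $ p i) s \<and>
      rat_eval (\<Prod>i\<in>UNIV. F $ i $ p i) s = (\<Prod>i\<in>UNIV. rat_eval (F $ i $ p i) s)" for p
    using assms by (intro rat_eval_prod) (simp add: ratmat_regular_at_def)
  have t: "rat_regular_at (?t p) s"
    "rat_eval (?t p) s = of_int (sign p) * (\<Prod>i\<in>UNIV. ratmat_eval F s $ i $ p i)" for p
    using rat_eval_mult[OF conjunct1[OF sgn] conjunct1[OF pr], of p p] conjunct2[OF pr, of p]
    by (simp_all only: conjunct2[OF sgn] ratmat_eval_nth)
  have "rat_regular_at (det F) s \<and>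
      rat_eval (det F) s = (\<Sum>p | p permutes UNIV. rat_eval (?t p) s)"
    unfolding det_def by (rule rat_eval_sum) (rule t(1))
  then show "rat_regular_at (det F) s" "rat_eval (det F) s = det (ratmat_eval F s)"
    unfolding t(2) by (simp_all only: det_def)
qed

text \<open>
  By Cramer's rule the entries of the inverse are quotients of determinants of matrices that are
  regular at \<open>s\<close>, with the common denominator \<open>det F\<close>, which does not vanish at \<open>s\<close>.
\<close>

lemma ratmat_eval_inverse:
  assumes F: "ratmat_regular_at F s" and d: "det (ratmat_eval F s) \<noteq> 0"
  shows "det F \<noteq> 0" "ratmat_regular_at (matrix_inv F) s"
proof -
  note det_F = ratmat_eval_det[OF F]
  show nz: "det F \<noteq> 0" using det_F d by (auto simp: rat_eval_0)
  then have "invertible F" by (simp add: invertible_det_nz)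
  then have inv: "F ** matrix_inv F = mat 1"
    unfolding invertible_def matrix_inv_def by (rule someI2_ex) simp
  have "rat_regular_at (matrix_inv F $ i $ k) s" for i k
  proof -
    let ?C = "\<chi> a b. if b = i then axis k 1 $ a else F $ a $ b"
    have "F *v (\<chi> i. matrix_inv F $ i $ k) = axis k 1"
      using inv by (simp add: vec_eq_iff matrix_vector_mult_def matrix_matrix_mult_def mat_def
          axis_def)
    then have "matrix_inv F $ i $ k = det ?C / det F"
      using cramer[OF nz] by (simp add: vec_eq_iff)
    moreover have "ratmat_regular_at ?C s"
      using F by (auto simp: ratmat_regular_at_def axis_def rat_eval_0 rat_eval_1)
    ultimately show ?thesis
      using det_F d by (simp add: divide_inverse rat_eval_mult rat_eval_inverse ratmat_eval_det)
  qed
  then show "ratmat_regular_at (matrix_inv F) s" by (simp add: ratmat_regular_at_def)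
qed

section \<open>The Cayley transform over a field\<close>

lemma matrix_mult_add_right: "(A + B) ** C = A ** C + B ** C"
  for A B :: "'a::semiring_1^'n::finite^'m" and C :: "'a^'k^'n"
  by (simp add: matrix_matrix_mult_def vec_eq_iff distrib_right sum.distrib)

lemma matrix_mult_diff_right: "(A - B) ** C = A ** C - B ** C"
  for A B :: "'a::ring_1^'n::finite^'m" and C :: "'a^'k^'n"
  by (simp add: matrix_matrix_mult_def vec_eq_iff left_diff_distrib sum_subtractf)

lemma matrix_inv_eqI:
  fixes A B :: "'a::field^'n^'n::finite"
  assumes "A ** B = mat 1"
  shows "matrix_inv A = B"
proof -
  have BA: "B ** A = mat 1" using assms matrix_left_right_inverse by blast
  show ?thesis unfolding matrix_inv_def
  proof (rule some_equality)
    fix C assume "A ** C = mat 1 \<and> C ** A = mat 1"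
    then show "C = B" by (metis BA matrix_mul_assoc matrix_mul_lid matrix_mul_rid)
  qed (use assms BA in simp)
qed

lemma matrix_inv_det_nz:
  fixes A :: "'a::field^'n^'n::finite"
  assumes "det A \<noteq> 0"
  shows "A ** matrix_inv A = mat 1" "matrix_inv A ** A = mat 1"
proof -
  have "invertible A" using assms by (simp add: invertible_det_nz)
  then obtain B where "A ** B = mat 1" "B ** A = mat 1" unfolding invertible_def by blast
  then show "A ** matrix_inv A = mat 1" "matrix_inv A ** A = mat 1"
    using matrix_inv_eqI by auto
qed

lemma det_eq_0_iff_kernel:
  fixes A :: "'a::field^'n^'n::finite"
  shows "det A = 0 \<longleftrightarrow> (\<exists>v. v \<noteq> 0 \<and> A *v v = 0)"
  using invertible_det_nz[of A] invertible_left_inverse[of A] matrix_left_invertible_ker[of A]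
  by blast

lemma minus_1_notin_spect_iff:
  fixes G :: "'a::field^'n^'n::finite"
  shows "-1 \<notin> spect G \<longleftrightarrow> det (mat 1 + G) \<noteq> 0"
proof -
  have "(mat 1 + G) *v v = 0 \<longleftrightarrow> G *v v = (-1) *s v" for v
    by (simp add: matrix_vector_mult_add_rdistrib add_eq_0_iff vec_eq_iff)
  then show ?thesis unfolding det_eq_0_iff_kernel by (auto simp: spect_def)
qed

lemma cayley_mult:
  fixes M :: "'a::field^'n^'n::finite"
  assumes "det (mat 1 + M) \<noteq> 0"
  shows "cayley M ** (mat 1 + M) = mat 1 - M"
  using matrix_inv_det_nz[OF assms] by (simp add: cayley_def matrix_mul_assoc[symmetric])

lemma cayley_eqI:
  fixes M :: "'a::field^'n^'n::finite"
  assumes "det (mat 1 + M) \<noteq> 0" "F ** (mat 1 + M) = mat 1 - M"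
  shows "cayley M = F"
  unfolding cayley_def assms(2)[symmetric]
  using matrix_inv_det_nz[OF assms(1)] by (simp add: matrix_mul_assoc[symmetric])

text \<open>
  If \<open>G\<close> is the Cayley transform of \<open>M\<close>, then \<open>(I + G) (I + M) = 2 I\<close> and \<open>(I - G) (I + M) = 2 M\<close>;
  dividing the second identity by the first gives \<open>M\<close> back, in characteristic other than 2.
\<close>

lemma cayley_involution:
  fixes M :: "'a::field^'n^'n::finite"
  assumes two: "(2::'a) \<noteq> 0" and nz: "det (mat 1 + M) \<noteq> 0"
  shows "det (mat 1 + cayley M) \<noteq> 0" "cayley (cayley M) = M"
proof -
  let ?G = "cayley M"
  have eq: "?G + ?G ** M = mat 1 - M"
    using cayley_mult[OF nz] by (simp add: matrix_add_ldistrib)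
  have "(mat 1 + ?G) ** (mat 1 + M) = mat 1 + M + (?G + ?G ** M)"
    by (simp add: matrix_mult_add_right matrix_add_ldistrib)
  also have "\<dots> = mat 2" unfolding eq by (simp add: vec_eq_iff mat_def)
  finally have prod: "(mat 1 + ?G) ** (mat 1 + M) = mat 2" .
  have "det (mat 2 :: 'a^'n^'n) = 2 ^ CARD('n)"
    by (subst det_diagonal) (auto simp: mat_def)
  then have "det (mat 1 + ?G) * det (mat 1 + M) \<noteq> 0"
    using two by (simp add: det_mul[symmetric] prod)
  then show nz': "det (mat 1 + ?G) \<noteq> 0" by simp
  have "(mat 1 - ?G) ** (mat 1 + M) = M + M"
    using cayley_mult[OF nz] by (simp add: matrix_mult_diff_right)
  also have "\<dots> = M ** mat 2"
    by (simp add: vec_eq_iff matrix_matrix_mult_def mat_def if_distrib cong: if_cong)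
  also have "\<dots> = M ** (mat 1 + ?G) ** (mat 1 + M)"
    by (simp add: matrix_mul_assoc[symmetric] prod)
  finally have "M ** (mat 1 + ?G) ** ((mat 1 + M) ** matrix_inv (mat 1 + M)) =
      (mat 1 - ?G) ** ((mat 1 + M) ** matrix_inv (mat 1 + M))"
    by (simp add: matrix_mul_assoc)
  then have "M ** (mat 1 + ?G) = mat 1 - ?G"
    by (simp add: matrix_inv_det_nz[OF nz])
  then show "cayley ?G = M" by (rule cayley_eqI[OF nz'])
qed

lemma inverse_cayley:
  fixes M :: "'a::field^'n^'n::finite"
  assumes nz: "det (mat 1 + M) \<noteq> 0" and F: "det (cayley M) \<noteq> 0"
  shows "det (mat 1 - M) \<noteq> 0" "matrix_inv (cayley M) = cayley (- M)"
proof -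
  have "det (mat 1 - M) = det (cayley M) * det (mat 1 + M)"
    by (simp add: cayley_mult[OF nz, symmetric] det_mul)
  then show nz': "det (mat 1 - M) \<noteq> 0" using nz F by simp
  have "matrix_inv (cayley M) ** (mat 1 - M) = mat 1 + M"
    using matrix_inv_det_nz(2)[OF F]
    by (simp add: cayley_mult[OF nz, symmetric] matrix_mul_assoc)
  then show "matrix_inv (cayley M) = cayley (- M)"
    using cayley_eqI[of "- M" "matrix_inv (cayley M)"] nz' by simp
qed

section \<open>Hyper-bounded and hyper-positive matrices as quadratic inequalities\<close>

lemma inner_complex_eq_cnj: "x \<bullet> y = Re (cnj x * y)" for x y :: complex
  by (simp add: inner_complex_def)

lemma inner_conj_transpose:
  fixes A :: "complex^'m::finite^'n::finite"
  shows "x \<bullet> (conj_transpose A *v y) = (A *v x) \<bullet> y"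
proof -
  have "x \<bullet> (conj_transpose A *v y) = Re (\<Sum>i\<in>UNIV. \<Sum>j\<in>UNIV. cnj (A $ j $ i * x $ i) * y $ j)"
    by (simp add: inner_vec_def inner_complex_eq_cnj matrix_vector_mult_def conj_transpose_def
        sum_distrib_left mult_ac)
  also have "\<dots> = Re (\<Sum>j\<in>UNIV. \<Sum>i\<in>UNIV. cnj (A $ j $ i * x $ i) * y $ j)"
    by (subst sum.swap) rule
  also have "\<dots> = (A *v x) \<bullet> y"
    by (simp add: inner_vec_def inner_complex_eq_cnj matrix_vector_mult_def sum_distrib_right)
  finally show ?thesis .
qed

text \<open>The defining matrix inequalities, in the form of quadratic forms on complex vectors.\<close>

definition hyper_bounded_matrix :: "real \<Rightarrow> complex^'m^'m::finite \<Rightarrow> bool" where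
  "hyper_bounded_matrix c A \<longleftrightarrow> (\<forall>v. c * (norm (A *v v))\<^sup>2 \<le> (norm v)\<^sup>2)"

text \<open>
  For \<open>c = (\<eta> + 1) / (\<eta> - 1)\<close>, division by \<open>c + 1\<close> turns this into positive semidefiniteness of
  \<open>A + A\<^sup>* - (A\<^sup>* A + I) / \<eta>\<close>.
\<close>

definition hyper_positive_matrix :: "real \<Rightarrow> complex^'m^'m::finite \<Rightarrow> bool" where
  "hyper_positive_matrix c A \<longleftrightarrow>
     (\<forall>v. (c - 1) * ((norm v)\<^sup>2 + (norm (A *v v))\<^sup>2) \<le> 2 * (c + 1) * (v \<bullet> (A *v v)))"

lemma pos_semidef_iff_hyper_bounded_matrix:
  fixes A :: "complex^'m::finite^'m"
  shows "pos_semidef (mat 1 - c *\<^sub>R (conj_transpose A ** A)) \<longleftrightarrow> hyper_bounded_matrix c A"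
proof -
  let ?B = "mat 1 - c *\<^sub>R (conj_transpose A ** A)"
  have herm: "conj_transpose ?B = ?B"
    by (auto simp: conj_transpose_def vec_eq_iff mat_def matrix_matrix_mult_def mult_ac
        intro!: sum.cong)
  have scale: "(c *\<^sub>R (conj_transpose A ** A)) *v v = c *\<^sub>R (conj_transpose A *v (A *v v))" for v
    by (simp add: matrix_vector_mul_assoc)
      (simp add: vec_eq_iff matrix_vector_mult_def scaleR_sum_right)
  have "Re (\<Sum>i\<in>UNIV. cnj (v $ i) * (?B *v v) $ i) = v \<bullet> (?B *v v)" for v
    by (simp add: inner_vec_def inner_complex_eq_cnj)
  also have "v \<bullet> (?B *v v) = (norm v)\<^sup>2 - c * (norm (A *v v))\<^sup>2" for v
    by (simp add: matrix_vector_mult_diff_rdistrib scale inner_diff_right inner_conj_transpose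
        power2_norm_eq_inner)
  finally show ?thesis unfolding pos_semidef_def hyper_bounded_matrix_def herm by simp
qed

lemma norm_add_diff_quadratic:
  fixes x y :: "'a::real_inner"
  shows "(norm (x + y))\<^sup>2 = (norm x)\<^sup>2 + 2 * (x \<bullet> y) + (norm y)\<^sup>2"
    "(norm (x - y))\<^sup>2 = (norm x)\<^sup>2 - 2 * (x \<bullet> y) + (norm y)\<^sup>2"
    "(x + y) \<bullet> (x - y) = (norm x)\<^sup>2 - (norm y)\<^sup>2"
  by (simp_all add: power2_norm_eq_inner inner_add_left inner_add_right inner_diff_left
      inner_diff_right inner_commute)

text \<open>
  The vectors \<open>w + G w\<close> exhaust the space, and for \<open>v = w + G w\<close> one has \<open>F v = w - G w\<close>,
  \<open>\<parallel>v\<parallel>\<^sup>2 + \<parallel>F v\<parallel>\<^sup>2 = 2 (\<parallel>w\<parallel>\<^sup>2 + \<parallel>G w\<parallel>\<^sup>2)\<close> and \<open>v \<bullet> F v = \<parallel>w\<parallel>\<^sup>2 - \<parallel>G w\<parallel>\<^sup>2\<close>.  Both inequalities are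
  therefore the same up to the factor 4.
\<close>

lemma hyper_positive_cayley_iff:
  fixes G :: "complex^'m::finite^'m"
  assumes nz: "det (mat 1 + G) \<noteq> 0"
  shows "hyper_positive_matrix c (cayley G) \<longleftrightarrow> hyper_bounded_matrix c G"
proof -
  let ?F = "cayley G"
  let ?v = "\<lambda>w. (mat 1 + G) *v w"
  have surj: "\<exists>w. v = ?v w" for v
    by (rule exI[of _ "matrix_inv (mat 1 + G) *v v"])
      (simp only: matrix_vector_mul_assoc matrix_inv_det_nz[OF nz] matrix_vector_mul_lid)
  have v: "?v w = w + G *v w" for w by (simp add: matrix_vector_mult_add_rdistrib)
  have Fv: "?F *v (w + G *v w) = w - G *v w" for w
    by (simp only: v[symmetric] matrix_vector_mul_assoc cayley_mult[OF nz] matrix_vector_mult_diff_rdistrib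
        matrix_vector_mul_lid)
  have "hyper_positive_matrix c ?F \<longleftrightarrow>
    (\<forall>w. (c - 1) * ((norm (w + G *v w))\<^sup>2 + (norm (w - G *v w))\<^sup>2)
         \<le> 2 * (c + 1) * ((w + G *v w) \<bullet> (w - G *v w)))"
    unfolding hyper_positive_matrix_def using surj v Fv by metis
  also have "\<dots> \<longleftrightarrow> (\<forall>w. c * (norm (G *v w))\<^sup>2 \<le> (norm w)\<^sup>2)"
    by (intro all_cong1) (simp only: norm_add_diff_quadratic, auto simp: algebra_simps)
  finally show ?thesis by (simp add: hyper_bounded_matrix_def)
qed

text \<open>
  On an eigenvector for \<open>-1\<close> the left side of the inequality is nonnegative, while the right side is
  negative.
\<close>

lemma hyper_positive_imp_det_nz:
  fixes A :: "complex^'m::finite^'m"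
  assumes "1 \<le> c" "hyper_positive_matrix c A"
  shows "det (mat 1 + A) \<noteq> 0"
proof
  assume "det (mat 1 + A) = 0"
  then obtain v where v: "v \<noteq> 0" "(mat 1 + A) *v v = 0" unfolding det_eq_0_iff_kernel by blast
  then have Av: "A *v v = - v"
    by (simp add: matrix_vector_mult_add_rdistrib add_eq_0_iff)
  have "(c - 1) * ((norm v)\<^sup>2 + (norm v)\<^sup>2) \<le> - (2 * (c + 1) * (norm v)\<^sup>2)"
    using assms(2)[unfolded hyper_positive_matrix_def, rule_format, of v] Av
    by (simp add: power2_norm_eq_inner)
  then have "4 * c * (norm v)\<^sup>2 \<le> 0" by (simp add: algebra_simps)
  then show False using v(1) assms(1) by (simp add: mult_le_0_iff)
qed

section \<open>The Cayley transform on the right half plane\<close>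

lemma right_half_plane_open_connected:
  "open right_half_plane" "connected right_half_plane" "infinite right_half_plane"
proof -
  show o: "open right_half_plane"
    unfolding right_half_plane_def by (rule open_halfspace_Re_gt)
  show "connected right_half_plane"
    unfolding right_half_plane_def by (intro convex_connected convex_halfspace_Re_gt)
  have "1 \<in> right_half_plane" by (simp add: right_half_plane_def)
  then show "infinite right_half_plane" using o finite_imp_not_open by blast
qed

text \<open>
  If \<open>G(s\<^sub>0) v = - v\<close>, then the real part of \<open>g(s) = v\<^sup>* G(s) v\<close> attains its smallest possible value
  \<open>- \<parallel>v\<parallel>\<^sup>2\<close> at the interior point \<open>s\<^sub>0\<close>, so \<open>Re g\<close> is constant.  Equality in the Cauchy-Schwarz
  inequality then gives \<open>G(s) v = - v\<close> at every \<open>s\<close>, and \<open>det (I + G)\<close> is identically zero.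
\<close>

lemma one_plus_contractive_nonsingular:
  fixes G :: "'m::finite ratmat"
  assumes reg: "\<And>s. s \<in> right_half_plane \<Longrightarrow> ratmat_regular_at G s"
    and bound: "\<And>s v. s \<in> right_half_plane \<Longrightarrow> norm (ratmat_eval G s *v v) \<le> norm v"
    and nz: "det (mat 1 + G) \<noteq> 0"
    and s0: "s0 \<in> right_half_plane"
  shows "det (mat 1 + ratmat_eval G s0) \<noteq> 0"
proof
  assume "det (mat 1 + ratmat_eval G s0) = 0"
  then obtain v where v: "v \<noteq> 0" "(mat 1 + ratmat_eval G s0) *v v = 0"
    unfolding det_eq_0_iff_kernel by blast
  then have Gv: "ratmat_eval G s0 *v v = - v"
    by (simp add: matrix_vector_mult_add_rdistrib add_eq_0_iff)
  define g where "g s = (\<Sum>i\<in>UNIV. cnj (v $ i) * (ratmat_eval G s *v v) $ i)" for s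
  have Re_g: "Re (g s) = v \<bullet> (ratmat_eval G s *v v)" for s
    by (simp add: g_def inner_vec_def inner_complex_eq_cnj)
  \<comment> \<open>The modulus of \<open>exp (- g s)\<close> is \<open>exp (- Re (g s))\<close>, so the maximum modulus principle for this
      function is a minimum principle for \<open>Re g\<close>.\<close>
  have "ratmat_analytic_on G right_half_plane"
    using reg by (simp add: ratmat_analytic_on_iff)
  then have "rat_eval (G $ i $ j) holomorphic_on right_half_plane" for i j
    by (auto simp: ratmat_analytic_on_def intro: analytic_imp_holomorphic)
  then have "(\<lambda>s. exp (- g s)) holomorphic_on right_half_plane"
    unfolding g_def matrix_vector_mult_def ratmat_eval_nth vec_lambda_beta
    by (intro holomorphic_intros)
  moreover have "- Re (g s) \<le> (norm v)\<^sup>2" if "s \<in> right_half_plane" for s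
  proof -
    have "\<bar>Re (g s)\<bar> \<le> norm v * norm (ratmat_eval G s *v v)"
      unfolding Re_g by (rule Cauchy_Schwarz_ineq2)
    also have "\<dots> \<le> norm v * norm v" using bound[OF that] by (simp add: mult_left_mono)
    finally show ?thesis by (simp add: power2_eq_square)
  qed
  moreover have g0: "Re (g s0) = - (norm v)\<^sup>2" by (simp add: Re_g Gv power2_norm_eq_inner)
  ultimately have "(\<lambda>s. exp (- g s)) constant_on right_half_plane"
    using right_half_plane_open_connected s0
    by (intro maximum_modulus_principle[where U = right_half_plane and \<xi> = s0]) auto
  then have const: "Re (g s) = - (norm v)\<^sup>2" if "s \<in> right_half_plane" for s
    using that s0 g0 unfolding constant_on_def
    by (metis exp_inj_iff norm_exp_eq_Re neg_equal_iff_equal uminus_complex.sel(1))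
  have "rat_eval (det (mat 1 + G)) s = 0" if s: "s \<in> right_half_plane" for s
  proof -
    let ?A = "ratmat_eval G s"
    have "(norm (v + ?A *v v))\<^sup>2 = (norm (?A *v v))\<^sup>2 - (norm v)\<^sup>2"
      using const[OF s] by (simp add: norm_add_diff_quadratic Re_g)
    also have "\<dots> \<le> 0" using bound[OF s, of v] by (simp add: power_mono)
    finally have "(mat 1 + ?A) *v v = 0" by (simp add: matrix_vector_mult_add_rdistrib)
    then have "det (mat 1 + ?A) = 0" using v(1) det_eq_0_iff_kernel by blast
    then show ?thesis
      using ratmat_eval_det(2)[OF ratmat_eval_add(1)[OF ratmat_eval_mat_1(1) reg[OF s]]]
      by (simp add: ratmat_eval_add ratmat_eval_mat_1 reg s)
  qed
  then have "det (mat 1 + G) = 0"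
    using ratfun_eq_0_if_eval_eq_0 right_half_plane_open_connected(3) by blast
  then show False using nz by simp
qed

lemma cayley_eval:
  fixes G :: "'m::finite ratmat"
  assumes reg: "ratmat_regular_at G s" and nz: "det (mat 1 + ratmat_eval G s) \<noteq> 0"
  shows "det (mat 1 + G) \<noteq> 0" "ratmat_regular_at (cayley G) s"
    "ratmat_eval (cayley G) s = cayley (ratmat_eval G s)"
proof -
  note one = ratmat_eval_mat_1[of s]
  note plus = ratmat_eval_add[OF one(1) reg] and minus = ratmat_eval_diff[OF one(1) reg]
  have nz': "det (ratmat_eval (mat 1 + G) s) \<noteq> 0" using nz by (simp add: plus one)
  note inv = ratmat_eval_inverse[OF plus(1) nz']
  show d: "det (mat 1 + G) \<noteq> 0" by (rule inv(1))
  show r: "ratmat_regular_at (cayley G) s"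
    unfolding cayley_def by (rule ratmat_eval_mult[OF minus(1) inv(2)])
  have "ratmat_eval (cayley G ** (mat 1 + G)) s = ratmat_eval (mat 1 - G) s"
    by (simp add: cayley_mult[OF d])
  then have "ratmat_eval (cayley G) s ** (mat 1 + ratmat_eval G s) = mat 1 - ratmat_eval G s"
    by (simp add: ratmat_eval_mult[OF r plus(1)] plus minus one)
  then show "ratmat_eval (cayley G) s = cayley (ratmat_eval G s)"
    by (rule cayley_eqI[OF nz, symmetric])
qed

lemma two_ratfun_neq_0: "(2 :: ratfun) \<noteq> 0"
proof
  assume "(2 :: ratfun) = 0"
  then have "rat_eval (1 + 1) 0 = rat_eval 0 0" by simp
  then show False by (simp only: rat_eval_add rat_eval_1 rat_eval_0) simp
qed

lemma HB_iff:
  "G \<in> HB \<eta> \<longleftrightarrow> (\<forall>s\<in>right_half_plane.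
     ratmat_regular_at G s \<and> hyper_bounded_matrix (hb_const \<eta>) (ratmat_eval G s))"
  by (auto simp: HB_def ratmat_analytic_on_iff pos_semidef_iff_hyper_bounded_matrix)

lemma hb_const_ge_1:
  assumes "1 < \<eta>"
  shows "1 \<le> hb_const \<eta>" "\<eta> \<noteq> \<infinity> \<Longrightarrow> 1 < hb_const \<eta>"
  using assms by (cases \<eta>; auto simp: hb_const_def)+

text \<open>
  The Cayley transform carries the pointwise inequality of \<open>G\<close> to that of \<open>F\<close> and back, at every
  point where \<open>-1\<close> is not an eigenvalue.  For \<open>G\<close> this holds everywhere by the maximum principle,
  for \<open>F\<close> by the inequality itself.
\<close>

lemma HP_iff:
  fixes F :: "'m::finite ratmat"
  assumes "1 < \<eta>"
  shows "F \<in> HP \<eta> \<longleftrightarrow> (\<forall>s\<in>right_half_plane.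
     ratmat_regular_at F s \<and> hyper_positive_matrix (hb_const \<eta>) (ratmat_eval F s))"
    (is "_ \<longleftrightarrow> ?R")
proof
  let ?c = "hb_const \<eta>"
  assume "F \<in> HP \<eta>"
  then obtain G where G: "G \<in> HB \<eta>" "det (mat 1 + G) \<noteq> 0" and F: "F = cayley G"
    by (auto simp: HP_def minus_1_notin_spect_iff)
  have reg: "ratmat_regular_at G s" and hb: "hyper_bounded_matrix ?c (ratmat_eval G s)"
    if "s \<in> right_half_plane" for s using G(1) that by (auto simp: HB_iff)
  have "norm (ratmat_eval G s *v v) \<le> norm v" if "s \<in> right_half_plane" for s v
  proof -
    have "1 * (norm (ratmat_eval G s *v v))\<^sup>2 \<le> ?c * (norm (ratmat_eval G s *v v))\<^sup>2"
      using hb_const_ge_1(1)[OF assms] by (intro mult_right_mono) auto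
    also have "\<dots> \<le> (norm v)\<^sup>2" using hb[OF that] by (simp add: hyper_bounded_matrix_def)
    finally show ?thesis by (simp add: power2_le_iff_abs_le)
  qed
  then have nz: "det (mat 1 + ratmat_eval G s) \<noteq> 0" if "s \<in> right_half_plane" for s
    using one_plus_contractive_nonsingular reg G(2) that by blast
  show ?R
    unfolding F using cayley_eval(2,3)[OF reg nz] hyper_positive_cayley_iff[OF nz] hb by simp
next
  let ?c = "hb_const \<eta>"
  assume R: ?R
  then have reg: "ratmat_regular_at F s"
    and hp: "hyper_positive_matrix ?c (ratmat_eval F s)"
    if "s \<in> right_half_plane" for s using that by auto
  have nz: "det (mat 1 + ratmat_eval F s) \<noteq> 0" if "s \<in> right_half_plane" for s
    using hyper_positive_imp_det_nz[OF hb_const_ge_1(1)[OF assms] hp[OF that]] .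
  have "1 \<in> right_half_plane" by (simp add: right_half_plane_def)
  then have "det (mat 1 + F) \<noteq> 0" using cayley_eval(1) reg nz by blast
  note inv = cayley_involution[OF two_ratfun_neq_0 this]
  have "cayley F \<in> HB \<eta>"
    unfolding HB_iff
  proof (intro ballI conjI)
    fix s assume s: "s \<in> right_half_plane"
    note F = reg[OF s] nz[OF s]
    show "ratmat_regular_at (cayley F) s" by (rule cayley_eval[OF F])
    note inv_s = cayley_involution[OF _ nz[OF s]]
    show "hyper_bounded_matrix ?c (ratmat_eval (cayley F) s)"
      using hp[OF s] hyper_positive_cayley_iff[OF inv_s(1), of ?c]
      by (simp add: inv_s(2) cayley_eval(3)[OF F])
  qed
  then show "F \<in> HP \<eta>"
    unfolding HP_def minus_1_notin_spect_iff using inv by (auto intro!: rev_image_eqI)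
qed

section \<open>Matrix convexity and inversion\<close>

lemma sum_matrix_vector_mult: "sum f J *v v = (\<Sum>j\<in>J. f j *v v)"
  for f :: "'i \<Rightarrow> 'a::semiring_1^'n::finite^'m"
  by (induction J rule: infinite_finite_induct) (simp_all add: matrix_vector_mult_add_rdistrib)

text \<open>
  The block column \<open>V\<close> with blocks \<open>\<upsilon> j\<close> is an isometry, and its adjoint is a contraction:
  for \<open>y = V\<^sup>* x\<close> one has \<open>2 \<parallel>y\<parallel>\<^sup>2 = 2 (V y \<bullet> x) \<le> \<parallel>V y\<parallel>\<^sup>2 + \<parallel>x\<parallel>\<^sup>2 = \<parallel>y\<parallel>\<^sup>2 + \<parallel>x\<parallel>\<^sup>2\<close>.
\<close>

lemma isometric_column_norm:
  fixes \<upsilon> :: "'i \<Rightarrow> complex^'m::finite^'m"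
  assumes "(\<Sum>j\<in>J. conj_transpose (\<upsilon> j) ** \<upsilon> j) = mat 1"
  shows "(\<Sum>j\<in>J. (norm (\<upsilon> j *v v))\<^sup>2) = (norm v)\<^sup>2"
    and "(norm (\<Sum>j\<in>J. conj_transpose (\<upsilon> j) *v x j))\<^sup>2 \<le> (\<Sum>j\<in>J. (norm (x j))\<^sup>2)"
proof -
  show iso: "(\<Sum>j\<in>J. (norm (\<upsilon> j *v v))\<^sup>2) = (norm v)\<^sup>2" for v
  proof -
    have "(norm v)\<^sup>2 = v \<bullet> ((\<Sum>j\<in>J. conj_transpose (\<upsilon> j) ** \<upsilon> j) *v v)"
      by (simp add: assms power2_norm_eq_inner)
    also have "\<dots> = (\<Sum>j\<in>J. (norm (\<upsilon> j *v v))\<^sup>2)"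
      by (simp add: sum_matrix_vector_mult inner_sum_right power2_norm_eq_inner inner_conj_transpose
          flip: matrix_vector_mul_assoc)
    finally show ?thesis by simp
  qed
  let ?y = "\<Sum>j\<in>J. conj_transpose (\<upsilon> j) *v x j"
  have young: "2 * (a \<bullet> b) \<le> (norm a)\<^sup>2 + (norm b)\<^sup>2" for a b :: "complex^'m"
    using zero_le_power2[of "norm (a - b)"] unfolding norm_add_diff_quadratic by linarith
  have "2 * (norm ?y)\<^sup>2 = (\<Sum>j\<in>J. 2 * ((\<upsilon> j *v ?y) \<bullet> x j))"
    by (simp add: power2_norm_eq_inner inner_sum_right[of ?y] inner_conj_transpose
        flip: sum_distrib_left)
  also have "\<dots> \<le> (\<Sum>j\<in>J. (norm (\<upsilon> j *v ?y))\<^sup>2 + (norm (x j))\<^sup>2)"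
    by (intro sum_mono young)
  also have "\<dots> = (norm ?y)\<^sup>2 + (\<Sum>j\<in>J. (norm (x j))\<^sup>2)" by (simp add: sum.distrib iso)
  finally show "(norm ?y)\<^sup>2 \<le> (\<Sum>j\<in>J. (norm (x j))\<^sup>2)" by simp
qed

text \<open>
  Summing the inequalities of the \<open>A j\<close> at the vectors \<open>w j = \<upsilon> j v\<close> gives exactly the right side
  \<open>v \<bullet> F v\<close> and exactly \<open>\<parallel>v\<parallel>\<^sup>2\<close>; only the norm of \<open>F v\<close> is estimated, by the contraction
  property, and this goes in the right direction since \<open>c - 1 \<ge> 0\<close>.
\<close>

lemma hyper_positive_matrix_convex:
  fixes \<upsilon> A :: "'i \<Rightarrow> complex^'m::finite^'m"
  assumes iso: "(\<Sum>j\<in>J. conj_transpose (\<upsilon> j) ** \<upsilon> j) = mat 1" and c: "1 \<le> c"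
    and A: "\<And>j. j \<in> J \<Longrightarrow> hyper_positive_matrix c (A j)"
  shows "hyper_positive_matrix c (\<Sum>j\<in>J. conj_transpose (\<upsilon> j) ** A j ** \<upsilon> j)"
  unfolding hyper_positive_matrix_def
proof
  fix v
  define w where "w j = \<upsilon> j *v v" for j
  have Fv: "(\<Sum>j\<in>J. conj_transpose (\<upsilon> j) ** A j ** \<upsilon> j) *v v =
      (\<Sum>j\<in>J. conj_transpose (\<upsilon> j) *v (A j *v w j))" (is "?F *v v = _")
    by (simp add: w_def sum_matrix_vector_mult flip: matrix_vector_mul_assoc)
  have "(norm v)\<^sup>2 + (norm (?F *v v))\<^sup>2 \<le> (\<Sum>j\<in>J. (norm (w j))\<^sup>2 + (norm (A j *v w j))\<^sup>2)"
    unfolding Fv sum.distrib w_def isometric_column_norm(1)[OF iso]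
    using isometric_column_norm(2)[OF iso] by simp
  then have "(c - 1) * ((norm v)\<^sup>2 + (norm (?F *v v))\<^sup>2) \<le>
      (\<Sum>j\<in>J. (c - 1) * ((norm (w j))\<^sup>2 + (norm (A j *v w j))\<^sup>2))"
    using c by (simp add: mult_left_mono flip: sum_distrib_left)
  also have "\<dots> \<le> (\<Sum>j\<in>J. 2 * (c + 1) * (w j \<bullet> (A j *v w j)))"
    using A by (intro sum_mono) (simp add: hyper_positive_matrix_def)
  also have "\<dots> = 2 * (c + 1) * (v \<bullet> (?F *v v))"
    by (simp add: Fv inner_sum_right inner_conj_transpose w_def flip: sum_distrib_left)
  finally show "(c - 1) * ((norm v)\<^sup>2 + (norm (?F *v v))\<^sup>2) \<le> 2 * (c + 1) * (v \<bullet> (?F *v v))" .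
qed

lemma HP_matrix_convex:
  assumes "1 < \<eta>"
  shows "matrix_convex (HP \<eta> :: 'm::finite ratmat set)"
  unfolding matrix_convex_def
proof (intro allI impI)
  fix k :: nat and \<upsilon> :: "nat \<Rightarrow> complex^'m^'m" and F :: "nat \<Rightarrow> 'm ratmat"
  assume iso: "(\<Sum>j<k. conj_transpose (\<upsilon> j) ** \<upsilon> j) = mat 1" and F: "\<forall>j<k. F j \<in> HP \<eta>"
  let ?T = "\<lambda>j. const_ratmat (conj_transpose (\<upsilon> j)) ** F j ** const_ratmat (\<upsilon> j)"
  show "sum ?T {..<k} \<in> HP \<eta>"
    unfolding HP_iff[OF assms]
  proof
    fix s assume s: "s \<in> right_half_plane"
    have Fj: "ratmat_regular_at (F j) s" "hyper_positive_matrix (hb_const \<eta>) (ratmat_eval (F j) s)"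
      if "j < k" for j using F that s by (auto simp: HP_iff[OF assms])
    have T: "ratmat_regular_at (?T j) s"
      "ratmat_eval (?T j) s = conj_transpose (\<upsilon> j) ** ratmat_eval (F j) s ** \<upsilon> j" if "j < k" for j
      using Fj(1)[OF that] by (simp_all add: ratmat_eval_mult ratmat_eval_const)
    have "ratmat_regular_at (sum ?T {..<k}) s \<and>
        ratmat_eval (sum ?T {..<k}) s = (\<Sum>j<k. ratmat_eval (?T j) s)"
      using T(1) by (intro ratmat_eval_sum) simp
    moreover have "hyper_positive_matrix (hb_const \<eta>) (\<Sum>j<k. ratmat_eval (?T j) s)"
      using hyper_positive_matrix_convex[OF iso hb_const_ge_1(1)[OF assms],
          of "\<lambda>j. ratmat_eval (F j) s"] Fj(2) T(2) by simp
    ultimately show "ratmat_regular_at (sum ?T {..<k}) s \<and>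
        hyper_positive_matrix (hb_const \<eta>) (ratmat_eval (sum ?T {..<k}) s)"
      by simp
  qed
qed

text \<open>
  For finite \<open>\<eta>\<close> the coefficient \<open>c - 1\<close> is positive, so the inequality at a vector of the kernel
  forces that vector to be zero.  One point suffices: a determinant that does not vanish at \<open>s = 1\<close>
  is not the zero function.
\<close>

lemma det_HP_neq_0:
  fixes F :: "'m::finite ratmat"
  assumes "1 < \<eta>" "\<eta> \<noteq> \<infinity>" "F \<in> HP \<eta>"
  shows "det F \<noteq> 0"
proof -
  let ?A = "ratmat_eval F 1"
  have "1 \<in> right_half_plane" by (simp add: right_half_plane_def)
  then have F: "ratmat_regular_at F 1" "hyper_positive_matrix (hb_const \<eta>) ?A"
    using assms by (auto simp: HP_iff)
  have "v = 0" if "?A *v v = 0" for v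
  proof -
    have "(hb_const \<eta> - 1) * (norm v)\<^sup>2 \<le> 0"
      using F(2)[unfolded hyper_positive_matrix_def, rule_format, of v] that by simp
    then show ?thesis using hb_const_ge_1(2)[OF assms(1,2)] by (simp add: mult_le_0_iff)
  qed
  then have "det ?A \<noteq> 0" using det_eq_0_iff_kernel by blast
  then show ?thesis by (rule ratmat_eval_inverse(1)[OF F(1)])
qed

text \<open>
  The inverse of the Cayley transform of \<open>G\<close> is the Cayley transform of \<open>- G\<close>, and the inequality
  that defines \<open>HB \<eta>\<close> does not see the sign of \<open>G\<close>.
\<close>

lemma HP_matrix_inv:
  fixes F :: "'m::finite ratmat"
  assumes "F \<in> HP \<eta>" "det F \<noteq> 0"
  shows "matrix_inv F \<in> HP \<eta>"
proof -
  obtain G where G: "G \<in> HB \<eta>" "det (mat 1 + G) \<noteq> 0" and F: "F = cayley G"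
    using assms(1) by (auto simp: HP_def minus_1_notin_spect_iff)
  have neg: "(- A) *v v = - (A *v v)" for A :: "complex^'m^'m" and v
    by (simp add: vec_eq_iff matrix_vector_mult_def sum_negf)
  have "- G \<in> HB \<eta>"
    using G(1) by (simp add: HB_iff ratmat_eval_uminus hyper_bounded_matrix_def neg)
  then show ?thesis
    using inverse_cayley[OF G(2) assms(2)[unfolded F]]
    unfolding HP_def F minus_1_notin_spect_iff by auto
qed

theorem proposition5p9:
  fixes \<eta> :: ereal
  assumes "1 < \<eta>"
  shows "matrix_convex (HP \<eta> :: 'm::finite ratmat set) \<and>
    (\<forall>F \<in> (HP \<eta> :: 'm ratmat set).
       (\<eta> = \<infinity> \<longrightarrow> det F \<noteq> 0) \<longrightarrow> invertible F \<and> matrix_inv F \<in> HP \<eta>)"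
proof (intro conjI ballI impI)
  show "matrix_convex (HP \<eta> :: 'm ratmat set)" by (rule HP_matrix_convex[OF assms])
next
  fix F :: "'m ratmat" assume F: "F \<in> HP \<eta>" and "\<eta> = \<infinity> \<longrightarrow> det F \<noteq> 0"
  then have nz: "det F \<noteq> 0" using det_HP_neq_0[OF assms] by blast
  then show "invertible F" by (simp add: invertible_det_nz)
  show "matrix_inv F \<in> HP \<eta>" by (rule HP_matrix_inv[OF F nz])
qed

end
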